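(* Let $m,f\in\mathcal C$. The set $\mathcal A(f,m)\neq\emptyset$ if and only if both of the following hold: (1) $m\prec f$, or there does not exist any $z\in\mathcal C$ such that $f\prec z\prec m$; (2) $f\notin\langle m\rangle$.
   Context: Notation: $\mathbb N=\{0,1,2,\dots\}$, $p\ge 1$, and $\Lambda=\{e_1,\dots,e_p\}$ is the canonical basis of $\mathbb N^p$; $\langle m\rangle=\{\lambda m\mid\lambda\in\mathbb N\}$. $\mathcal C\subseteq\mathbb N^p$ is a fixed non-negative integer cone (the set of points of $\mathbb N^p$ lying in a finitely generated rational convex cone), with at least $p$ extremal rays. A $\mathcal C$-semigroup is an infinite, finitely generated submonoid $S\subseteq\mathcal C$ of $\mathbb N^p$ such that the minimal integer cone containing $S$ is $\mathcal C$ and $\mathcal H(S)=\mathcal C\setminus S$ is finite. A monomial order $\preceq$ on $\mathbb N^p$ is fixed: a total order compatible with addition with $0\preceq x$ for all $x$; it is assumed that $\{x\in\mathcal C\mid x\preceq k\}$ is finite for every $k\in\mathcal C$. $\operatorname{Fb}(S)=\max_\preceq\mathcal H(S)$ (and $-\sum_i e_i$ if $\mathcal H(S)=\emptyset$), $\operatorname{N}(S)=\{x\in S\mid x\prec\operatorname{Fb}(S)\}$, $\operatorname{m}(S)=\min_\preceq(S\setminus\{0\})$. A $\mathcal C$-semigroup $S$ is an $\mathcal A$-semigroup if for every $s\in S$ and $e\in\Lambda$ the set $\{s,s+e\}$ is not contained in $\operatorname{N}(S)$. $\mathcal A(f,m)$ is the set of all $\mathcal A$-semigroups $S$ with $\operatorname{Fb}(S)=f$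 and $\operatorname{m}(S)=m$.
   Formalization: Added hypothesis: if m is 0 or a canonical basis vector e_i and m ≺ f, then f ∈ ⟨m⟩. In the excluded cases (1) and (2) hold but A(f,m) is empty (e.g. C=N², graded lex with e_1≺e_2, m=e_1, f=e_1+e_2). *)

theory Defs
  imports "HOL-Analysis.Analysis"
begin

definition canonical_basis :: "(nat ^ 'p) set" where
  "canonical_basis = range (\<lambda>i. axis i 1)"

definition multiples :: "nat ^ 'p \<Rightarrow> (nat ^ 'p) set" where
  "multiples m = range (\<lambda>k. k *s m)"

definition real_vec :: "nat ^ 'p \<Rightarrow> real ^ 'p" where
  "real_vec x = (\<chi> i. real (x $ i))"

definition int_vec :: "nat ^ 'p \<Rightarrow> int ^ 'p" where
  "int_vec x = (\<chi> i. int (x $ i))"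

definition integer_cone :: "(nat ^ 'p) set \<Rightarrow> bool" where
  "integer_cone C \<longleftrightarrow>
     (\<exists>A :: (real ^ 'p) set. finite A \<and> (\<forall>a\<in>A. \<forall>i. a $ i \<in> \<rat>) \<and>
        C = {x. real_vec x \<in> convex_cone hull A})"

(* The real cone spanned by C lies in the non-negative orthant, so it is pointed and its
   one-dimensional faces are exactly its extremal rays. *)
definition extremal_rays :: "(nat ^ 'p) set \<Rightarrow> (real ^ 'p) set set" where
  "extremal_rays C = {R. R face_of (convex_cone hull (real_vec ` C)) \<and> aff_dim R = 1}"

definition strict :: "('a \<Rightarrow> 'a \<Rightarrow> bool) \<Rightarrow> 'a \<Rightarrow> 'a \<Rightarrow> bool" where
  "strict le x y \<longleftrightarrow> le x y \<and> x \<noteq> y"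

(* The order is an explicit argument because type vec carries the componentwise order. *)
definition monomial_order :: "(nat ^ 'p \<Rightarrow> nat ^ 'p \<Rightarrow> bool) \<Rightarrow> bool" where
  "monomial_order le \<longleftrightarrow>
     class.linorder le (strict le) \<and>
     (\<forall>x y z. le x y \<longrightarrow> le (x + z) (y + z)) \<and>
     (\<forall>x. le 0 x)"

definition submonoid :: "(nat ^ 'p) set \<Rightarrow> bool" where
  "submonoid S \<longleftrightarrow> 0 \<in> S \<and> (\<forall>x\<in>S. \<forall>y\<in>S. x + y \<in> S)"

definition gaps :: "(nat ^ 'p) set \<Rightarrow> (nat ^ 'p) set \<Rightarrow> (nat ^ 'p) set" where
  "gaps C S = C - S"

definition C_semigroup :: "(nat ^ 'p) set \<Rightarrow> (nat ^ 'p) set \<Rightarrow> bool" where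
  "C_semigroup C S \<longleftrightarrow>
     submonoid S \<and> S \<subseteq> C \<and> infinite S \<and>
     (\<exists>G. finite G \<and> S = submonoid hull G) \<and>
     integer_cone C \<and> (\<forall>D. integer_cone D \<and> S \<subseteq> D \<longrightarrow> C \<subseteq> D) \<and>
     finite (gaps C S)"

definition Fb :: "(nat ^ 'p \<Rightarrow> nat ^ 'p \<Rightarrow> bool) \<Rightarrow> (nat ^ 'p) set \<Rightarrow> (nat ^ 'p) set \<Rightarrow> int ^ 'p" where
  "Fb le C S =
     (if gaps C S = {} then - (\<Sum>i\<in>UNIV. axis i 1)
      else int_vec (order.Greatest le (\<lambda>x. x \<in> gaps C S)))"

(* Fb has values in the integer lattice while the monomial order lives on natural vectors;
   for an S without gaps, Fb has no natural preimage and small_elements is empty. *)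
definition small_elements ::
  "(nat ^ 'p \<Rightarrow> nat ^ 'p \<Rightarrow> bool) \<Rightarrow> (nat ^ 'p) set \<Rightarrow> (nat ^ 'p) set \<Rightarrow> (nat ^ 'p) set" where
  "small_elements le C S = {x \<in> S. \<exists>y. int_vec y = Fb le C S \<and> strict le x y}"

definition multiplicity_of ::
  "(nat ^ 'p \<Rightarrow> nat ^ 'p \<Rightarrow> bool) \<Rightarrow> (nat ^ 'p) set \<Rightarrow> nat ^ 'p" where
  "multiplicity_of le S = ord.Least le (\<lambda>x. x \<in> S - {0})"

definition A_semigroup ::
  "(nat ^ 'p \<Rightarrow> nat ^ 'p \<Rightarrow> bool) \<Rightarrow> (nat ^ 'p) set \<Rightarrow> (nat ^ 'p) set \<Rightarrow> bool" where
  "A_semigroup le C S \<longleftrightarrow>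
     C_semigroup C S \<and>
     (\<forall>s\<in>S. \<forall>e\<in>canonical_basis. \<not> {s, s + e} \<subseteq> small_elements le C S)"

definition A_family ::
  "(nat ^ 'p \<Rightarrow> nat ^ 'p \<Rightarrow> bool) \<Rightarrow> (nat ^ 'p) set \<Rightarrow> nat ^ 'p \<Rightarrow> nat ^ 'p \<Rightarrow> (nat ^ 'p) set set" where
  "A_family le C f m =
     {S. A_semigroup le C S \<and> Fb le C S = int_vec f \<and> multiplicity_of le S = m}"

end

theory Submission
  imports Defs
begin

text \<open>
  Both conditions are forced on a member \<open>S\<close> of \<open>A_family le C f m\<close>: the submonoid \<open>S\<close> contains
  every multiple of \<open>m\<close> but not its gap \<open>f\<close>, and a point of \<open>C\<close> strictly between \<open>f\<close> and \<open>m\<close>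
  would be a nonzero element of \<open>S\<close> below the least one.

  Conversely, the witness is the smallest possible candidate: the multiples of \<open>m\<close> together with
  everything in \<open>C\<close> above \<open>f\<close>. The points above \<open>f\<close> absorb addition, so this set is a submonoid,
  and no gap exceeds \<open>f\<close>, so there are finitely many gaps. It is an \<open>A_semigroup\<close> because its
  elements below \<open>f\<close> are multiples of \<open>m\<close>: two of them can differ by a basis vector only if \<open>m\<close>
  is that vector and lies below \<open>f\<close>, and then the last hypothesis of the theorem gives a contradiction
  (\<open>multiples_Un_above_mem_A_family\<close>).

  The work is in showing that the witness is finitely generated. More generally, every
  submonoid \<open>S\<close> of \<open>C\<close> with finite complement in \<open>C\<close> is generated by its irreducible elements. Were
  there infinitely many, then infinitely many of them would be of the form \<open>x + y\<close> with \<open>x\<close> a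
  fixed irreducible and \<open>y \<in> C\<close>; all but finitely many of these \<open>y\<close> lie in \<open>S\<close>, which makes
  \<open>x + y\<close> reducible (\<open>cofinite_submonoid_finitely_generated\<close>). The existence of such an \<open>x\<close> in any
  infinite subset of \<open>C\<close> (\<open>integer_cone_infinite_difference\<close>) combines the two classical ingredients
  of Gordan's lemma. Writing a point as a non-negative combination of the rational generators of
  the cone and rounding the coefficients down leaves one of finitely many remainders; Dickson's
  lemma applied to the coordinates and the rounded coefficients of points with a common
  remainder makes the differences non-negative combinations again.
\<close>

section \<open>A well-quasi-order on integer cones\<close>

lemma nat_seq_incseq_subseq:
  fixes s :: "nat \<Rightarrow> nat"
  obtains r where "strict_mono r" and "incseq (s \<circ> r)"
proof -
  obtain r where r: "strict_mono r" "monoseq (\<lambda>n. s (r n))"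
    using seq_monosub by blast
  show thesis
  proof (cases "incseq (\<lambda>n. s (r n))")
    case True
    then show thesis using r that by (simp add: comp_def)
  next
    case False
    then have dec: "decseq (\<lambda>n. s (r n))"
      using r by (auto simp: monoseq_iff)
    \<comment> \<open>A decreasing sequence of naturals is constant from the point on where it attains its minimum.\<close>
    define v where "v = (LEAST k. k \<in> range (\<lambda>n. s (r n)))"
    have "v \<in> range (\<lambda>n. s (r n))"
      unfolding v_def by (rule LeastI_ex) auto
    then obtain n0 where n0: "v = s (r n0)" by auto
    have ge: "v \<le> s (r n)" for n
      unfolding v_def by (rule Least_le) auto
    have const: "s (r n) = v" if "n \<ge> n0" for n
      using decseqD [OF dec that] ge [of n] n0 by simp
    have "strict_mono (\<lambda>n. r (n + n0))"
      using r(1) by (simp add: strict_mono_def)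
    moreover have "incseq (s \<circ> (\<lambda>n. r (n + n0)))"
      by (simp add: incseq_def const)
    ultimately show thesis using that by blast
  qed
qed

text \<open>
  Dickson's lemma in sequence form: the subsequences for the individual coordinates are extracted
  one after the other, each refining the previous one.
\<close>
lemma finite_family_incseq_subseq:
  fixes s :: "nat \<Rightarrow> 'i \<Rightarrow> nat"
  assumes "finite I"
  shows "\<exists>r. strict_mono r \<and> (\<forall>i\<in>I. incseq (\<lambda>n. s (r n) i))"
  using assms
proof (induction I rule: finite_induct)
  case empty
  show ?case by (auto intro: exI [of _ id] simp: strict_mono_def)
next
  case (insert j I)
  then obtain r where r: "strict_mono r" "\<forall>i\<in>I. incseq (\<lambda>n. s (r n) i)" by blast
  obtain q where q: "strict_mono q" "incseq ((\<lambda>n. s (r n) j) \<circ> q)"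
    by (rule nat_seq_incseq_subseq)
  have "strict_mono (r \<circ> q)" using r q by (simp add: strict_mono_o)
  moreover have "incseq (\<lambda>n. s ((r \<circ> q) n) i)" if "i \<in> insert j I" for i
    using that
  proof
    assume "i = j"
    then show ?thesis using q by (simp add: comp_def)
  next
    assume "i \<in> I"
    with r q(1) show ?thesis
      by (auto simp: incseq_def strict_mono_less_eq)
  qed
  ultimately show ?case by blast
qed

lemma convex_cone_hull_finite_subset:
  assumes "finite A"
  shows "convex_cone hull A \<subseteq> {y. \<exists>u. (\<forall>a\<in>A. 0 \<le> u a) \<and> y = (\<Sum>a\<in>A. u a *\<^sub>R a)}"
    (is "_ \<subseteq> ?K")
proof (rule hull_minimal)
  show "A \<subseteq> ?K"
  proof
    fix a assume "a \<in> A"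
    then have "a = (\<Sum>b\<in>A. (if b = a then 1 else 0) *\<^sub>R b)"
      using assms by (simp add: if_distrib [of "\<lambda>c. c *\<^sub>R _"] cong: if_cong)
    then show "a \<in> ?K"
      by (intro CollectI exI [of _ "\<lambda>b. if b = a then 1 else 0"]) auto
  qed
  show "convex_cone ?K"
    unfolding convex_cone_iff
  proof (intro conjI ballI allI impI)
    show "0 \<in> ?K" by (auto intro: exI [of _ "\<lambda>_. 0"])
  next
    fix x y assume "x \<in> ?K" "y \<in> ?K"
    then obtain u v where "\<forall>a\<in>A. 0 \<le> u a" "x = (\<Sum>a\<in>A. u a *\<^sub>R a)"
      "\<forall>a\<in>A. 0 \<le> v a" "y = (\<Sum>a\<in>A. v a *\<^sub>R a)" by auto
    then show "x + y \<in> ?K"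
      by (intro CollectI exI [of _ "\<lambda>a. u a + v a"])
         (auto simp: scaleR_add_left sum.distrib)
  next
    fix x and c :: real assume "x \<in> ?K" "c \<ge> 0"
    then obtain u where "\<forall>a\<in>A. 0 \<le> u a" "x = (\<Sum>a\<in>A. u a *\<^sub>R a)" by auto
    with \<open>c \<ge> 0\<close> show "c *\<^sub>R x \<in> ?K"
      by (intro CollectI exI [of _ "\<lambda>a. c * u a"]) (auto simp: scaleR_sum_right)
  qed
qed

lemma common_denominator:
  fixes Q :: "real set"
  assumes "finite Q" and "Q \<subseteq> \<rat>"
  shows "\<exists>d::nat. d > 0 \<and> (\<forall>q\<in>Q. real d * q \<in> \<int>)"
  using assms
proof (induction Q rule: finite_induct)
  case empty
  then show ?case by (auto intro: exI [of _ 1])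
next
  case (insert q Q)
  then obtain d :: nat where d: "d > 0" "\<forall>q\<in>Q. real d * q \<in> \<int>" by auto
  from insert.prems have "q \<in> \<rat>" by simp
  then obtain m n where mn: "n \<noteq> 0" "\<bar>q\<bar> = real m / real n"
    by (rule Rats_abs_nat_div_natE)
  have abs: "real n * \<bar>q\<bar> = real m" using mn by simp
  have n: "real n * q \<in> \<int>"
  proof (cases "q \<ge> 0")
    case True
    with abs show ?thesis by simp
  next
    case False
    with abs have "real n * q = - real m" by simp
    then show ?thesis by simp
  qed
  have "real (n * d) * p \<in> \<int>" if p: "p \<in> insert q Q" for p
  proof (cases "p = q")
    case True
    have "real d * (real n * q) \<in> \<int>" by (rule Ints_mult [OF Ints_of_nat n])
    with True show ?thesis by (simp add: mult.assoc mult.left_commute)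
  next
    case False
    with p d have "real d * p \<in> \<int>" by blast
    then have "real n * (real d * p) \<in> \<int>" by (rule Ints_mult [OF Ints_of_nat])
    then show ?thesis by (simp add: mult.assoc)
  qed
  with d mn show ?case by (intro exI [of _ "n * d"]) auto
qed

text \<open>
  Scaled by \<open>d\<close>, these points are integer vectors in a box.
\<close>
lemma finite_bounded_lattice_points:
  fixes d B :: real
  assumes "d > 0"
  shows "finite {x :: real ^ 'n. \<forall>i. d * x $ i \<in> \<int> \<and> \<bar>x $ i\<bar> \<le> B}" (is "finite ?X")
proof -
  let ?F = "{g :: int ^ 'n. \<forall>i. g $ i \<in> {\<lfloor>- d * B\<rfloor>..\<lceil>d * B\<rceil>}}"
  have "?X \<subseteq> (\<lambda>g. \<chi> i. of_int (g $ i) / d) ` ?F"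
  proof
    fix x assume x: "x \<in> ?X"
    define g :: "int ^ 'n" where "g = (\<chi> i. \<lfloor>d * x $ i\<rfloor>)"
    have g: "of_int (g $ i) = d * x $ i" for i
      using x by (simp add: g_def)
    have "x = (\<chi> i. of_int (g $ i) / d)"
      using assms by (simp add: g vec_eq_iff)
    moreover have "g \<in> ?F"
    proof (intro CollectI allI)
      fix i
      have "\<bar>x $ i\<bar> \<le> B" using x by simp
      then have "d * x $ i \<le> d * B" "d * (- B) \<le> d * x $ i"
        using assms by (intro mult_left_mono; simp add: abs_le_iff)+
      then have "- d * B \<le> d * x $ i" "d * x $ i \<le> d * B" by simp_all
      then have "- d * B \<le> of_int (g $ i)" "of_int (g $ i) \<le> d * B"
        by (simp_all add: g)
      then show "g $ i \<in> {\<lfloor>- d * B\<rfloor>..\<lceil>d * B\<rceil>}"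
        by (simp add: le_ceiling_iff floor_le_iff)
    qed
    ultimately show "x \<in> (\<lambda>g. \<chi> i. of_int (g $ i) / d) ` ?F" by blast
  qed
  moreover have "finite ?F"
  proof (rule finite_subset)
    show "?F \<subseteq> vec_lambda ` (UNIV \<rightarrow>\<^sub>E {\<lfloor>- d * B\<rfloor>..\<lceil>d * B\<rceil>})"
      by (auto intro!: image_eqI [where x = "vec_nth _"])
    show "finite (vec_lambda ` (UNIV \<rightarrow>\<^sub>E {\<lfloor>- d * B\<rfloor>..\<lceil>d * B\<rceil>}))"
      by (intro finite_imageI finite_PiE) auto
  qed
  ultimately show ?thesis by (meson finite_surj)
qed

lemma real_vec_add: "real_vec (x + y) = real_vec x + real_vec y"
  by (simp add: real_vec_def vec_eq_iff)

lemma real_vec_smult: "real_vec (k *s x) = real k *\<^sub>R real_vec x"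
  by (simp add: real_vec_def vec_eq_iff)

text \<open>
  This is the form in which the finiteness of integer cones is used: ordered by \<open>y - x \<in> C\<close>, the cone
  \<open>C\<close> is a well-quasi-order, so some element of an infinite set lies below infinitely many others.
  The generators of the cone may have negative entries. Therefore Dickson's lemma is applied to
  the coordinates of the points as well as to their rounded coefficients: the former make the
  difference a vector of naturals, the latter put it into the cone.
\<close>
lemma integer_cone_infinite_difference:
  fixes C :: "(nat ^ 'p) set"
  assumes "integer_cone C" and "T \<subseteq> C" and "infinite T"
  shows "\<exists>x\<in>T. infinite {y \<in> C. x + y \<in> T}"
proof -
  obtain A :: "(real ^ 'p) set" where A: "finite A" "\<forall>a\<in>A. \<forall>i. a $ i \<in> \<rat>"
    and C: "C = {x. real_vec x \<in> convex_cone hull A}"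
    using assms(1) unfolding integer_cone_def by blast
  have "\<forall>x\<in>T. \<exists>u. (\<forall>a\<in>A. 0 \<le> u a) \<and> real_vec x = (\<Sum>a\<in>A. u a *\<^sub>R a)"
    using assms(2) convex_cone_hull_finite_subset [OF A(1)] C by blast
  then obtain u where u: "\<And>x a. x \<in> T \<Longrightarrow> a \<in> A \<Longrightarrow> 0 \<le> u x a"
    and ux: "\<And>x. x \<in> T \<Longrightarrow> real_vec x = (\<Sum>a\<in>A. u x a *\<^sub>R a)"
    by metis
  \<comment> \<open>Rounding down the coefficients leaves a remainder \<open>R x\<close> that is bounded and has a bounded denominator.\<close>
  define n where "n x a = nat \<lfloor>u x a\<rfloor>" for x a
  define R where "R x = real_vec x - (\<Sum>a\<in>A. real (n x a) *\<^sub>R a)" for x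
  have frac: "0 \<le> u x a - real (n x a)" "u x a - real (n x a) \<le> 1" if "x \<in> T" "a \<in> A" for x a
    using u [OF that] unfolding n_def by (simp_all, linarith)
  have R_frac: "R x = (\<Sum>a\<in>A. (u x a - real (n x a)) *\<^sub>R a)" if "x \<in> T" for x
    using ux [OF that] by (simp add: R_def scaleR_diff_left sum_subtractf)

  have "\<exists>d::nat. d > 0 \<and> (\<forall>q\<in>(\<lambda>(a, i). a $ i) ` (A \<times> UNIV). real d * q \<in> \<int>)"
    using A by (intro common_denominator) auto
  then obtain d :: nat where d: "d > 0" "\<And>a i. a \<in> A \<Longrightarrow> real d * a $ i \<in> \<int>"
    by fastforce
  have "R ` T \<subseteq> {x. \<forall>i. real d * x $ i \<in> \<int> \<and> \<bar>x $ i\<bar> \<le> (\<Sum>a\<in>A. norm a)}"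
  proof (intro image_subsetI CollectI allI conjI)
    fix x i assume x: "x \<in> T"
    have "real d * R x $ i =
        real (d * x $ i) - (\<Sum>a\<in>A. real (n x a) * (real d * a $ i))"
      by (simp add: R_def real_vec_def sum_distrib_left algebra_simps)
    also have "\<dots> \<in> \<int>"
      by (intro Ints_diff Ints_sum Ints_of_nat Ints_mult [OF Ints_of_nat] d(2))
    finally show "real d * R x $ i \<in> \<int>" .
    have "\<bar>R x $ i\<bar> \<le> norm (R x)" by (rule component_le_norm_cart)
    also have "\<dots> \<le> (\<Sum>a\<in>A. norm ((u x a - real (n x a)) *\<^sub>R a))"
      unfolding R_frac [OF x] by (rule norm_sum)
    also have "\<dots> \<le> (\<Sum>a\<in>A. norm a)"
      using frac [OF x] by (intro sum_mono) (auto intro: mult_left_le_one_le)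
    finally show "\<bar>R x $ i\<bar> \<le> (\<Sum>a\<in>A. norm a)" .
  qed
  then have "finite (R ` T)"
    by (rule finite_subset) (use d in \<open>simp add: finite_bounded_lattice_points\<close>)
  then obtain x0 where x0: "infinite {x \<in> T. R x = R x0}"
    using pigeonhole_infinite [OF assms(3)] by blast
  then obtain s :: "nat \<Rightarrow> nat ^ 'p" where s: "inj s" "range s \<subseteq> {x \<in> T. R x = R x0}"
    using infinite_countable_subset by blast
  then have sT: "s k \<in> T" and sR: "R (s k) = R x0" for k by auto

  \<comment> \<open>Along a subsequence \<open>t\<close> of points with the same remainder, coordinates and rounded
    coefficients both increase.\<close>
  obtain r1 where r1: "strict_mono r1" "\<forall>i\<in>UNIV. incseq (\<lambda>k. s (r1 k) $ i)"
    using finite_family_incseq_subseq [of UNIV "\<lambda>k i. s k $ i"] by auto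
  obtain r2 where r2: "strict_mono r2" "\<forall>a\<in>A. incseq (\<lambda>k. n (s (r1 (r2 k))) a)"
    using finite_family_incseq_subseq [of A "\<lambda>k a. n (s (r1 k)) a"] A by auto
  define t where "t k = s (r1 (r2 k))" for k
  have t_inj: "inj t"
  proof (rule injI)
    fix j k assume "t j = t k"
    then have "r1 (r2 j) = r1 (r2 k)" using s(1) by (auto simp: t_def dest: injD)
    then show "j = k" using r1(1) r2(1) by (simp add: strict_mono_eq)
  qed
  have t_mono: "t 0 $ i \<le> t k $ i" for k i
  proof -
    have "r2 0 \<le> r2 k" using r2(1) by (simp add: strict_mono_less_eq)
    then show ?thesis using r1(2) by (auto simp: t_def incseq_def)
  qed
  have n_mono: "n (t 0) a \<le> n (t k) a" if "a \<in> A" for k a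
    using r2(2) that unfolding t_def incseq_def by blast
  define y where "y k = t k - t 0" for k
  have ty: "t k = t 0 + y k" for k
    using t_mono by (simp add: y_def vec_eq_iff)
  have "y k \<in> C" for k
  proof -
    have "R (t k) = R (t 0)" by (simp add: t_def sR)
    then have "real_vec (y k) = (\<Sum>a\<in>A. real (n (t k) a) *\<^sub>R a) - (\<Sum>a\<in>A. real (n (t 0) a) *\<^sub>R a)"
      using real_vec_add [of "t 0" "y k"] ty [of k] by (simp add: R_def algebra_simps)
    \<comment> \<open>Monotonicity of the coefficients makes the truncated subtraction exact.\<close>
    also have "\<dots> = (\<Sum>a\<in>A. real (n (t k) a - n (t 0) a) *\<^sub>R a)"
      unfolding sum_subtractf [symmetric]
      by (rule sum.cong) (auto simp: n_mono of_nat_diff scaleR_diff_left)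
    also have "\<dots> \<in> convex_cone hull A"
    proof -
      have "(\<Sum>a\<in>B. real (c a) *\<^sub>R a) \<in> convex_cone hull A" if "finite B" "B \<subseteq> A" for B and c :: "_ \<Rightarrow> nat"
        using that
      proof (induction B rule: finite_induct)
        case empty
        show ?case by (simp add: convex_cone_hull_contains_0)
      next
        case (insert b B)
        then have "real (c b) *\<^sub>R b \<in> convex_cone hull A"
          by (intro convex_cone_hull_mul hull_inc) simp_all
        with insert show ?case by (simp add: convex_cone_hull_add)
      qed
      from this [OF A(1) subset_refl] show ?thesis .
    qed
    finally show ?thesis by (simp add: C)
  qed
  moreover have "inj y"
    using t_inj by (metis injD injI ty)
  moreover have tT: "t k \<in> T" for k by (simp add: t_def sT)
  then have "t 0 + y k \<in> T" for k by (metis ty)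
  ultimately have "infinite {z \<in> C. t 0 + z \<in> T}"
    by (intro infinite_super [OF _ range_inj_infinite [of y]]) blast+
  with tT show ?thesis by blast
qed

section \<open>Cofinite submonoids of an integer cone\<close>

lemma integer_cone_add: "integer_cone C \<Longrightarrow> x \<in> C \<Longrightarrow> y \<in> C \<Longrightarrow> x + y \<in> C"
  by (auto simp: integer_cone_def real_vec_add convex_cone_hull_add)

lemma integer_cone_smult: "integer_cone C \<Longrightarrow> x \<in> C \<Longrightarrow> k *s x \<in> C"
  by (auto simp: integer_cone_def real_vec_smult convex_cone_hull_mul)

lemma integer_cone_smult_cancel:
  assumes "integer_cone C" and "k *s x \<in> C" and "k > 0"
  shows "x \<in> C"
proof -
  obtain A where C: "C = {x. real_vec x \<in> convex_cone hull A}"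
    using assms(1) unfolding integer_cone_def by blast
  have "(1 / real k) *\<^sub>R real_vec (k *s x) \<in> convex_cone hull A"
    using assms(2) C by (intro convex_cone_hull_mul) auto
  then show ?thesis using assms(3) by (simp add: C real_vec_smult)
qed

lemma inj_smult: "x \<noteq> 0 \<Longrightarrow> inj (\<lambda>k. k *s x)" for x :: "nat ^ 'p"
  by (auto simp: inj_def vec_eq_iff)

text \<open>
  The generators are the irreducible elements of \<open>S\<close>. They generate because splitting an element into
  nonzero summands decreases the sum of the coordinates. There are finitely many because
  infinitely many would include, for one fixed irreducible \<open>x\<close>, infinitely many \<open>x + y\<close> with \<open>y \<in> C\<close>,
  while only finitely many \<open>y \<in> C\<close> avoid \<open>S\<close>.
\<close>
lemma cofinite_submonoid_finitely_generated:
  assumes "integer_cone C" and S: "submonoid S" "S \<subseteq> C" and fin: "finite (C - S)"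
  shows "\<exists>G. finite G \<and> S = submonoid hull G"
proof -
  define G where "G = {s \<in> S - {0}. \<not> (\<exists>a\<in>S - {0}. \<exists>b\<in>S - {0}. s = a + b)}"
  have "finite G"
  proof (rule ccontr)
    assume "infinite G"
    moreover have "G \<subseteq> C" using S by (auto simp: G_def)
    ultimately obtain x where x: "x \<in> G" "infinite {y \<in> C. x + y \<in> G}"
      using integer_cone_infinite_difference [OF assms(1)] by blast
    then have "\<not> {y \<in> C. x + y \<in> G} \<subseteq> insert 0 (C - S)"
      using fin by (meson finite_insert finite_subset)
    then obtain y where "x + y \<in> G" "y \<in> S - {0}" by auto
    with x(1) show False by (auto simp: G_def)
  qed
  moreover have "S \<subseteq> submonoid hull G"
  proof
    have hull: "submonoid (submonoid hull G)"
      by (rule hull_in) (auto simp: submonoid_def)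
    show "x \<in> submonoid hull G" if "x \<in> S" for x
      using that
    proof (induction "\<Sum>i\<in>UNIV. x $ i" arbitrary: x rule: less_induct)
      case less
      consider "x = 0" | "x \<in> G" | a b where "a \<in> S - {0}" "b \<in> S - {0}" "x = a + b"
        using less.prems by (auto simp: G_def)
      then show ?case
      proof cases
        case 1
        then show ?thesis using hull by (simp add: submonoid_def)
      next
        case 2
        then show ?thesis by (rule hull_inc)
      next
        case 3
        have pos: "(\<Sum>i\<in>UNIV. c $ i) > 0" if "c \<noteq> 0" for c :: "nat ^ 'a"
          using that by (auto simp: vec_eq_iff intro: gr0I)
        have "(\<Sum>i\<in>UNIV. x $ i) = (\<Sum>i\<in>UNIV. a $ i) + (\<Sum>i\<in>UNIV. b $ i)"
          using 3 by (simp add: sum.distrib)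
        with 3 pos [of a] pos [of b] have "a \<in> submonoid hull G" "b \<in> submonoid hull G"
          by (auto intro!: less.hyps)
        then show ?thesis using hull 3 by (simp add: submonoid_def)
      qed
    qed
  qed
  moreover have "submonoid hull G \<subseteq> S"
    using S by (intro hull_minimal) (auto simp: G_def)
  ultimately show ?thesis by blast
qed

text \<open>
  On the ray through a nonzero \<open>x\<close> of \<open>C\<close> lie infinitely many multiples of \<open>x\<close>, so one of them avoids the
  finite complement of \<open>S\<close>, and a cone that contains it contains \<open>x\<close>.
\<close>
lemma cofinite_submonoid_spans_cone:
  assumes C: "integer_cone C" and S: "0 \<in> S" "finite (C - S)"
    and D: "integer_cone D" "S \<subseteq> D"
  shows "C \<subseteq> D"
proof
  fix x assume x: "x \<in> C"
  show "x \<in> D"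
  proof (cases "x = 0")
    case True
    then show ?thesis using S D by auto
  next
    case False
    have "infinite (range (\<lambda>k. Suc k *s x))"
      using inj_smult [OF False] by (intro range_inj_infinite) (auto simp: inj_def)
    then have "\<not> range (\<lambda>k. Suc k *s x) \<subseteq> C - S"
      using S(2) by (meson finite_subset)
    then obtain k where "Suc k *s x \<in> S"
      using integer_cone_smult [OF C x] by auto
    then show ?thesis using D by (auto intro: integer_cone_smult_cancel)
  qed
qed

lemma cofinite_submonoid_C_semigroup:
  assumes "integer_cone C" and "submonoid S" and "S \<subseteq> C" and "finite (C - S)" and "infinite C"
  shows "C_semigroup C S"
proof -
  have "infinite S"
    using assms(3-5) by (metis Diff_infinite_finite double_diff subset_refl)
  moreover have "0 \<in> S" using assms(2) by (simp add: submonoid_def)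
  moreover have "\<exists>G. finite G \<and> S = submonoid hull G"
    using assms(1-4) by (rule cofinite_submonoid_finitely_generated)
  ultimately show ?thesis
    unfolding C_semigroup_def gaps_def
    using assms(1-4) cofinite_submonoid_spans_cone [OF assms(1) _ assms(4)]
    by (intro conjI allI impI) simp_all
qed

section \<open>Frobenius element and multiplicity\<close>

lemma int_vec_inject [simp]: "int_vec x = int_vec y \<longleftrightarrow> x = y"
  by (simp add: int_vec_def vec_eq_iff)

text \<open>
  The conventional Frobenius element of a semigroup without gaps is never a vector of naturals, so
  a member of \<open>A_family le C f m\<close> always has gaps.
\<close>
lemma int_vec_not_minus_ones: "int_vec x \<noteq> - (\<Sum>i\<in>UNIV. axis i 1)"
proof
  assume "int_vec x = - (\<Sum>i\<in>UNIV. axis i 1)"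
  then have "int_vec x $ j = - (\<Sum>i\<in>UNIV. axis i 1 $ j)" for j by simp
  moreover have "(\<Sum>i\<in>UNIV. axis i 1 $ j) = (1 :: int)" for j :: 'a
    by (simp add: axis_def)
  ultimately have "int (x $ j) = - 1" for j by (simp add: int_vec_def)
  from this [of undefined] show False by simp
qed

lemma Fb_eq_int_vec_iff:
  fixes le :: "nat ^ 'p \<Rightarrow> nat ^ 'p \<Rightarrow> bool"
  assumes "monomial_order le" and "finite (C - S)"
  shows "Fb le C S = int_vec f \<longleftrightarrow> f \<in> C - S \<and> (\<forall>x\<in>C - S. le x f)"
proof -
  interpret o: linorder le "strict le"
    using assms(1) by (simp add: monomial_order_def)
  show ?thesis
  proof (cases "C - S = {}")
    case True
    then show ?thesis using int_vec_not_minus_ones [of f] by (auto simp: Fb_def gaps_def)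
  next
    case False
    define g where "g = o.Max (C - S)"
    have g: "g \<in> C - S" "\<And>x. x \<in> C - S \<Longrightarrow> le x g"
      using False assms(2) by (simp_all add: g_def o.Max_in del: Diff_iff)
    then have "order.Greatest le (\<lambda>x. x \<in> C - S) = g"
      by (intro o.Greatest_equality)
    then have "Fb le C S = int_vec f \<longleftrightarrow> f = g"
      using False by (auto simp: Fb_def gaps_def)
    then show ?thesis using g o.order.antisym by blast
  qed
qed

text \<open>
  Below any nonzero element of \<open>S\<close> there are only finitely many points of \<open>C\<close>, so the
  least among those of them that are nonzero and in \<open>S\<close> is the least nonzero element of \<open>S\<close>.
\<close>
lemma multiplicity_of_least:
  fixes le :: "nat ^ 'p \<Rightarrow> nat ^ 'p \<Rightarrow> bool"
  assumes "monomial_order le" and "\<forall>k\<in>C. finite {x \<in> C. le x k}" and "S \<subseteq> C" and "S - {0} \<noteq> {}"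
  shows "multiplicity_of le S \<in> S - {0}" and "x \<in> S - {0} \<Longrightarrow> le (multiplicity_of le S) x"
proof -
  interpret o: linorder le "strict le"
    using assms(1) by (simp add: monomial_order_def)
  obtain k where k: "k \<in> S - {0}" using assms(4) by blast
  define B where "B = {x \<in> S - {0}. le x k}"
  have B: "finite B" "B \<noteq> {}"
    using assms(2,3) k by (auto simp: B_def intro: finite_subset [of _ "{x \<in> C. le x k}"])
  define g where "g = o.Min B"
  have g: "g \<in> B" "\<And>x. x \<in> B \<Longrightarrow> le g x"
    using B by (simp_all add: g_def)
  have least: "le g x" if "x \<in> S - {0}" for x
    using g that o.linear [of x k] unfolding B_def by (blast intro: o.order.trans)
  have "multiplicity_of le S = g"
    unfolding multiplicity_of_def using g(1) least
    by (intro o.Least_equality) (auto simp: B_def)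
  with g(1) least show "multiplicity_of le S \<in> S - {0}"
    and "x \<in> S - {0} \<Longrightarrow> le (multiplicity_of le S) x"
    by (auto simp: B_def)
qed

lemma multiples_subset_submonoid:
  assumes "submonoid S" and "m \<in> S"
  shows "multiples m \<subseteq> S"
proof -
  have "k *s m \<in> S" for k
  proof (induction k)
    case 0
    then show ?case using assms by (simp add: submonoid_def)
  next
    case (Suc k)
    have "Suc k *s m = m + k *s m" by (simp add: vec_eq_iff)
    with Suc assms show ?case by (simp add: submonoid_def)
  qed
  then show ?thesis by (auto simp: multiples_def)
qed

lemma submonoid_multiples: "submonoid (multiples m)"
proof -
  have "0 \<in> multiples m"
    unfolding multiples_def by (rule range_eqI [of _ _ 0]) simp
  moreover have "x + y \<in> multiples m" if xy: "x \<in> multiples m" "y \<in> multiples m" for x y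
  proof -
    obtain k l where "x = k *s m" "y = l *s m" using xy unfolding multiples_def by blast
    then have "x + y = (k + l) *s m" by (simp only: vector_sadd_rdistrib)
    then show ?thesis unfolding multiples_def by blast
  qed
  ultimately show ?thesis by (simp add: submonoid_def)
qed

text \<open>
  In the \<open>i\<close>-th coordinate the hypothesis says that \<open>m $ i\<close> divides \<open>1\<close>, which forces \<open>l = k + 1\<close>.
\<close>
lemma multiples_differ_by_axis:
  fixes m :: "nat ^ 'p"
  assumes "k *s m + axis i 1 = l *s m"
  shows "m = axis i 1"
proof -
  have "(k *s m + axis i 1) $ i = (l *s m) $ i" using assms by (rule arg_cong)
  then have "k * m $ i + 1 = l * m $ i" by (simp add: axis_def)
  then have "m $ i dvd 1" by (metis dvd_add_right_iff dvd_triv_right)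
  then have "m $ i = 1" by simp
  with \<open>k * m $ i + 1 = l * m $ i\<close> have "l = k + 1" by simp
  then have "l *s m = k *s m + m" by (simp add: vec_eq_iff)
  with assms show ?thesis by simp
qed

section \<open>The criterion\<close>

lemma A_family_member_necessary:
  fixes le :: "nat ^ 'p \<Rightarrow> nat ^ 'p \<Rightarrow> bool"
  assumes mono: "monomial_order le" and fin: "\<forall>k\<in>C. finite {x \<in> C. le x k}"
    and S: "S \<in> A_family le C f m"
  shows "f \<notin> multiples m" and "strict le m f \<or> \<not> (\<exists>z\<in>C. strict le f z \<and> strict le z m)"
proof -
  interpret o: linorder le "strict le"
    using mono by (simp add: monomial_order_def)
  have sub: "submonoid S" and SC: "S \<subseteq> C" and "infinite S" and "finite (C - S)"
    and Fb: "Fb le C S = int_vec f" and m: "multiplicity_of le S = m"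
    using S by (auto simp: A_family_def A_semigroup_def C_semigroup_def gaps_def)
  have f: "f \<in> C - S" "\<And>x. x \<in> C - S \<Longrightarrow> le x f"
    using Fb Fb_eq_int_vec_iff [OF mono \<open>finite (C - S)\<close>] by auto
  have "S - {0} \<noteq> {}"
    using \<open>infinite S\<close> by (metis Diff_eq_empty_iff finite.simps finite_subset)
  note least = multiplicity_of_least [OF mono fin SC this, unfolded m]
  show "f \<notin> multiples m"
    using f(1) multiples_subset_submonoid [OF sub] least(1) by blast
  have "\<not> (strict le f z \<and> strict le z m)" if "z \<in> C" for z
  proof
    assume z: "strict le f z \<and> strict le z m"
    then have "z \<notin> C - S" using f(2) o.leD by blast
    moreover have "z \<noteq> 0"
      using z mono o.leD by (auto simp: monomial_order_def)
    ultimately have "le m z" using that least(2) by blast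
    with z show False using o.leD by blast
  qed
  then show "strict le m f \<or> \<not> (\<exists>z\<in>C. strict le f z \<and> strict le z m)" by blast
qed

text \<open>
  One witness serves both alternatives of the first condition. If \<open>m\<close> lies above \<open>f\<close>, then the nonzero
  multiples of \<open>m\<close> already lie above \<open>f\<close>, and the set is \<open>0\<close> together with all points above \<open>f\<close>, the
  least of which is \<open>m\<close> because there is nothing in between.
\<close>
lemma multiples_Un_above_mem_A_family:
  fixes le :: "nat ^ 'p \<Rightarrow> nat ^ 'p \<Rightarrow> bool"
  assumes C: "integer_cone C" and mono: "monomial_order le"
    and fin: "\<forall>k\<in>C. finite {x \<in> C. le x k}"
    and m: "m \<in> C" and f: "f \<in> C"
    and basis: "m \<in> canonical_basis \<Longrightarrow> \<not> strict le m f" and "m \<noteq> 0"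
    and nobetween: "strict le m f \<or> \<not> (\<exists>z\<in>C. strict le f z \<and> strict le z m)"
    and nmult: "f \<notin> multiples m"
  shows "multiples m \<union> {x \<in> C. strict le f x} \<in> A_family le C f m"
proof -
  interpret o: linorder le "strict le"
    using mono by (simp add: monomial_order_def)
  have pos: "le 0 x" and add_mono: "le x y \<Longrightarrow> le (x + z) (y + z)" for x y z
    using mono by (auto simp: monomial_order_def)
  have le_add: "le x (x + y)" for x y
    using add_mono [OF pos [of y], of x] by (simp add: add.commute)
  define S where "S = multiples m \<union> {x \<in> C. strict le f x}"
  have multC: "multiples m \<subseteq> C"
    using integer_cone_smult [OF C m] by (auto simp: multiples_def)
  have m_mult: "m \<in> multiples m"
    unfolding multiples_def by (rule range_eqI [of _ _ 1]) (simp add: vec_eq_iff)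
  have m_least: "le m x" if x: "x \<in> multiples m" "x \<noteq> 0" for x
  proof -
    obtain k where k: "x = k *s m" using x by (auto simp: multiples_def)
    with x(2) obtain j where "k = Suc j" by (cases k) auto
    then have "x = m + j *s m" using k by (simp add: vec_eq_iff)
    then show ?thesis using le_add by simp
  qed
  have SC: "S \<subseteq> C" using multC by (auto simp: S_def)
  have fS: "f \<in> C - S" using f nmult by (auto simp: S_def)
  have gaps_le: "le x f" if "x \<in> C - S" for x
    using that o.not_less by (auto simp: S_def)
  have finite_gaps: "finite (C - S)"
    using fin f gaps_le by (auto intro: finite_subset [of _ "{x \<in> C. le x f}"])
  have submonoid: "submonoid S"
  proof -
    have absorb: "x + y \<in> S" if "strict le f x" "x \<in> C" "y \<in> C" for x y
      using that integer_cone_add [OF C] o.less_le_trans [OF _ le_add]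
      by (auto simp: S_def)
    show ?thesis
      unfolding submonoid_def
    proof (intro conjI ballI)
      show "0 \<in> S" using submonoid_multiples by (auto simp: S_def submonoid_def)
      fix x y assume xy: "x \<in> S" "y \<in> S"
      then consider "x \<in> multiples m" "y \<in> multiples m" | "strict le f x" | "strict le f y"
        by (auto simp: S_def)
      then show "x + y \<in> S"
      proof cases
        case 1
        then show ?thesis using submonoid_multiples by (auto simp: S_def submonoid_def)
      next
        case 2
        then show ?thesis using absorb xy SC by blast
      next
        case 3
        then show ?thesis using absorb [of y x] xy SC by (auto simp: add.commute)
      qed
    qed
  qed
  have "infinite C"
    using range_inj_infinite [OF inj_smult [OF \<open>m \<noteq> 0\<close>]] multC finite_subset
    unfolding multiples_def by blast
  then have "C_semigroup C S"
    using C submonoid SC finite_gaps by (intro cofinite_submonoid_C_semigroup)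
  moreover have Fb: "Fb le C S = int_vec f"
    using Fb_eq_int_vec_iff [OF mono finite_gaps] fS gaps_le by blast
  moreover have "multiplicity_of le S = m"
    unfolding multiplicity_of_def
  proof (rule o.Least_equality)
    show "m \<in> S - {0}" using m_mult \<open>m \<noteq> 0\<close> by (simp add: S_def)
    fix x assume x: "x \<in> S - {0}"
    show "le m x"
    proof (cases "x \<in> multiples m")
      case True
      then show ?thesis using m_least x by blast
    next
      case False
      with x have "x \<in> C" "strict le f x" by (auto simp: S_def)
      then show ?thesis
        using nobetween o.less_trans o.not_less o.less_imp_le by blast
    qed
  qed
  moreover have "\<not> {s, s + e} \<subseteq> small_elements le C S" if e_basis: "e \<in> canonical_basis" for s e
  proof
    assume small: "{s, s + e} \<subseteq> small_elements le C S"
    have "small_elements le C S = {x \<in> S. strict le x f}"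
      by (auto simp: small_elements_def Fb)
    then have s: "s \<in> multiples m" "s + e \<in> multiples m" "strict le (s + e) f"
      using small o.less_asym by (auto simp: S_def)
    obtain i where e: "e = axis i 1" using e_basis by (auto simp: canonical_basis_def)
    then have "m = e"
      using s(1,2) multiples_differ_by_axis by (auto simp: multiples_def)
    \<comment> \<open>As a nonzero multiple of \<open>m\<close> below \<open>f\<close>, the element \<open>s + e\<close> shows that \<open>m\<close> lies below \<open>f\<close>,
      which a basis vector does not.\<close>
    have "e \<noteq> 0" by (simp add: e)
    then have "s + e \<noteq> 0" by (auto simp: vec_eq_iff)
    then have "strict le m f" using m_least s(2,3) o.le_less_trans by blast
    then show False using basis \<open>m = e\<close> e_basis by blast
  qed
  ultimately show ?thesis
    unfolding S_def [symmetric] A_family_def A_semigroup_def by blast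
qed

theorem proposition25:
  fixes C :: "(nat ^ 'p) set"
    and le :: "nat ^ 'p \<Rightarrow> nat ^ 'p \<Rightarrow> bool"
    and m f :: "nat ^ 'p"
  assumes "integer_cone C"
    and "card (extremal_rays C) \<ge> CARD('p)"
    and "monomial_order le"
    and "\<forall>k\<in>C. finite {x \<in> C. le x k}"
    and "m \<in> C" and "f \<in> C"
    and "m \<in> insert 0 canonical_basis \<Longrightarrow> strict le m f \<Longrightarrow> f \<in> multiples m"
  shows "A_family le C f m \<noteq> {} \<longleftrightarrow>
    (strict le m f \<or> \<not> (\<exists>z\<in>C. strict le f z \<and> strict le z m)) \<and>
    f \<notin> multiples m"
proof
  assume "A_family le C f m \<noteq> {}"
  then show "(strict le m f \<or> \<not> (\<exists>z\<in>C. strict le f z \<and> strict le z m)) \<and> f \<notin> multiples m"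
    using A_family_member_necessary [OF assms(3,4)] by blast
next
  assume cond: "(strict le m f \<or> \<not> (\<exists>z\<in>C. strict le f z \<and> strict le z m)) \<and> f \<notin> multiples m"
  \<comment> \<open>If \<open>m\<close> were \<open>0\<close>, then \<open>m\<close> would lie strictly below the non-multiple \<open>f\<close>, against the last hypothesis.\<close>
  have "m \<noteq> 0"
  proof
    assume "m = 0"
    have "f \<noteq> 0"
      using cond submonoid_multiples [of m] by (auto simp: submonoid_def)
    moreover have "le 0 f" using assms(3) by (simp add: monomial_order_def)
    ultimately have "strict le m f" using \<open>m = 0\<close> by (simp add: strict_def)
    then show False using assms(7) cond \<open>m = 0\<close> by blast
  qed
  then have "multiples m \<union> {x \<in> C. strict le f x} \<in> A_family le C f m"
    using assms(7) cond
    by (intro multiples_Un_above_mem_A_family assms(1,3-6)) auto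
  then show "A_family le C f m \<noteq> {}" by blast
qed

end
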